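(* Let $N,L,K$ be non-negative integers and let $q,a,b,c,b',c',b'',c''$ be nonzero complex numbers with $|q|<1$, such that no denominator appearing below vanishes. Then $$\sum_{n=0}^{N}\sum_{l=0}^{L}\sum_{k=0}^{K}\frac{(qa;q)_{n+l+k}}{(qa;q)_{n+l}(qa;q)_{n+k}(qa;q)_{l+k}}\cdot\frac{(b,c,q^{-N};q)_n}{(q,\,bcq^{-N}/a;q)_n}\cdot\frac{(b',c',q^{-L};q)_l}{(q,\,b'c'q^{-L}/a;q)_l}\cdot\frac{(b'',c'',q^{-K};q)_k}{(q,\,b''c''q^{-K}/a;q)_k}\;q^{n+l+k}$$ $$=\frac{(qa/b,\,qa/c;q)_N}{(qa,\,qa/(bc);q)_N}\cdot\frac{(qa/b',\,qa/c';q)_L}{(qa,\,qa/(b'c');q)_L}\cdot\frac{(qa/b'',\,qa/c'';q)_K}{(qa,\,qa/(b''c'');q)_K}$$ $$\times\;{}_{12}W_{11}\!\left(a;b,c,b',c',b'',c'',q^{-N},q^{-L},q^{-K};q,\frac{a^4q^{N+L+K+4}}{bcb'c'b''c''}\right).$$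
   Context: Notation: $(x;q)_n=\prod_{j=0}^{n-1}(1-xq^j)$ for integers $n\ge0$, and $(x_1,\dots,x_r;q)_n=\prod_{i}(x_i;q)_n$. The very-well-poised series is $${}_{r+1}W_r(a;a_1,\dots,a_{r-2};q,z)=\sum_{m\ge0}\frac{(a,q\sqrt a,-q\sqrt a,a_1,\dots,a_{r-2};q)_m}{(q,\sqrt a,-\sqrt a,qa/a_1,\dots,qa/a_{r-2};q)_m}z^m,$$ where $\sqrt a$ is a fixed square root of $a$ (so $\frac{(q\sqrt a,-q\sqrt a;q)_m}{(\sqrt a,-\sqrt a;q)_m}=\frac{1-aq^{2m}}{1-a}$). Here it terminates because $q^{-N},q^{-L},q^{-K}$ are among the parameters: all terms with $m>\min(N,L,K)$ are zero. *)

theory Defs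
  imports "HOL-Analysis.Analysis"
begin

definition qpoch :: "complex \<Rightarrow> complex \<Rightarrow> nat \<Rightarrow> complex" where
  "qpoch x q n = (\<Prod>j<n. 1 - x * q ^ j)"

definition qpochs :: "complex list \<Rightarrow> complex \<Rightarrow> nat \<Rightarrow> complex" where
  "qpochs xs q n = (\<Prod>x\<leftarrow>xs. qpoch x q n)"

text \<open>
  The very-well-poised series with \<open>as = [a\<^sub>1, \<dots>, a\<^sub>r\<^sub>-\<^sub>2]\<close>; the index \<open>r\<close> is
  \<open>length as + 2\<close>. The fixed square root of \<open>a\<close> is the principal one; the terms are
  invariant under changing its sign.
\<close>

definition vwp_num :: "complex \<Rightarrow> complex list \<Rightarrow> complex \<Rightarrow> nat \<Rightarrow> complex" where
  "vwp_num a as q m = qpochs ([a, q * csqrt a, - q * csqrt a] @ as) q m"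

definition vwp_den :: "complex \<Rightarrow> complex list \<Rightarrow> complex \<Rightarrow> nat \<Rightarrow> complex" where
  "vwp_den a as q m = qpochs ([q, csqrt a, - csqrt a] @ map (\<lambda>x. q * a / x) as) q m"

text \<open>
  If some entry of \<open>as\<close> is \<open>q\<^sup>-\<^sup>M\<close>, then \<open>vwp_num\<close> vanishes for \<open>m > M\<close>, so those
  terms are zero whatever the value of \<open>vwp_den\<close>, since \<open>0 / 0 = 0\<close>.
\<close>

definition vwp_W :: "complex \<Rightarrow> complex list \<Rightarrow> complex \<Rightarrow> complex \<Rightarrow> complex" where
  "vwp_W a as q z = (\<Sum>m. vwp_num a as q m / vwp_den a as q m * z ^ m)"

end

(*
  Bailey's lemma, applied to each of the triples (b, c, q^-N), (b', c', q^-L), (b'', c'', q^-K),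
  writes the m-th term of the 12W11 series, prefactors included, as an elementary weight times a
  product of three single sums over the Bailey matrix 1 / ((q)_(n-m) (qa)_(n+m)).  After
  interchanging summations, the sum over m is a terminating very-well-poised 6-phi-5 with
  parameters q^-n, q^-l, q^-k, and its closed form is the mixed factor on the left.  The 6-phi-5
  sum is in turn Bailey's lemma applied to the unit Bailey pair.
*)
theory Submission
  imports Defs
begin

text \<open>The 6-phi-5 expansion separates variables: each of its terms is a product of one factor
  in \<open>n\<close>, one in \<open>l\<close> and one in \<open>k\<close>. Only zeros of the
  displayed denominators are excluded, and this decides the form of the lemmas. The numerator
  (qa)_{n+l+k} may vanish, and so may (qa)_{2n} when \<open>n\<close> is large compared with
  \<open>L\<close> and \<open>K\<close>. Hence Bailey's lemma is first proved with (e)_{N-n} as a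
  factor, e = qa/(bc), a form that survives (e)_N = 0: inside the 6-phi-5 sum b = q^-l, c = q^-k, N
  = n, and (qa)_{l+k} (e)_n is exactly (qa)_{n+l+k}. A reversed form, which divides by (e)_N, serves
  the three outer applications, where (e)_N is a displayed denominator. Since a = 1 is possible when
  one of \<open>N\<close>, \<open>L\<close>, \<open>K\<close> is 0, the quotient (1 - a q^(2m)) / (1
  - a) is absorbed into (a)_m.\<close>

section \<open>Shifted factorials: splitting, nonvanishing, base q^-N\<close>

lemma qpoch_0 [simp]: "qpoch x q 0 = 1"
  by (simp add: qpoch_def)

lemma qpoch_Suc: "qpoch x q (Suc n) = qpoch x q n * (1 - x * q ^ n)"
  by (simp add: qpoch_def)

lemma qpoch_add: "qpoch x q (m + n) = qpoch x q m * qpoch (x * q ^ m) q n"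
  by (induction n) (simp_all add: qpoch_Suc power_add mult_ac)

lemma qpoch_Suc_shift: "qpoch x q (Suc n) = (1 - x) * qpoch (x * q) q n"
  using qpoch_add[of x q 1 n] by (simp add: qpoch_Suc)

lemma qpoch_split: "m \<le> n \<Longrightarrow> qpoch x q n = qpoch x q m * qpoch (x * q ^ m) q (n - m)"
  using qpoch_add[of x q m "n - m"] by simp

lemma qpoch_nonzero_mono: "qpoch x q n \<noteq> 0 \<Longrightarrow> m \<le> n \<Longrightarrow> qpoch x q m \<noteq> 0"
  using qpoch_split[of m n x q] by auto

lemma power_neq_1:
  fixes q :: complex
  assumes "norm q < 1" "n > 0"
  shows "q ^ n \<noteq> 1"
proof
  assume "q ^ n = 1"
  then have "norm q ^ n = 1" by (metis norm_one norm_power)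
  then show False using assms power_less_one_iff[of "norm q" n] by simp
qed

lemma qpoch_self_nonzero:
  assumes "norm q < 1"
  shows "qpoch q q n \<noteq> 0"
proof -
  have "q * q ^ j \<noteq> 1" for j using power_neq_1[OF assms, of "Suc j"] by simp
  then show ?thesis by (auto simp: qpoch_def)
qed

text \<open>Each factor 1 - q^(j-N) equals -q^(j-N) (1 - q^(N-j)), and the factors 1 - q^(N-j) with
  j < m are the top \<open>m\<close> factors of (q)_N.\<close>

lemma qpoch_neg_power:
  assumes "q \<noteq> 0" "m \<le> N"
  shows "qpoch (inverse (q ^ N)) q m * qpoch q q (N - m) * q ^ (N * m)
         = (- 1) ^ m * q ^ (m choose 2) * qpoch q q N"
  using assms(2)
proof (induction m)
  case 0
  show ?case by (simp add: numeral_2_eq_2)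
next
  case (Suc m)
  have ch: "Suc m choose 2 = m + (m choose 2)" by (simp add: numeral_2_eq_2)
  have nm: "N - m = Suc (N - Suc m)" using Suc.prems by simp
  have qN: "q ^ N = q ^ m * (q * q ^ (N - Suc m))"
    using Suc.prems by (metis nm power_Suc le_add_diff_inverse Suc_leD power_add)
  have f: "(1 - inverse (q ^ N) * q ^ m) * q ^ N = - (q ^ m * (1 - q * q ^ (N - Suc m)))"
    using assms(1) by (simp add: left_diff_distrib) (simp add: qN algebra_simps)
  have "qpoch (inverse (q ^ N)) q (Suc m) * qpoch q q (N - Suc m) * q ^ (N * Suc m)
      = qpoch (inverse (q ^ N)) q m * qpoch q q (N - Suc m) * q ^ (N * m)
        * ((1 - inverse (q ^ N) * q ^ m) * q ^ N)"
    by (simp add: qpoch_Suc power_add mult_ac)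
  also have "\<dots> = - (q ^ m) * (qpoch (inverse (q ^ N)) q m * qpoch q q (N - m) * q ^ (N * m))"
    unfolding f by (simp add: nm qpoch_Suc mult_ac)
  also have "\<dots> = (- 1) ^ Suc m * q ^ (Suc m choose 2) * qpoch q q N"
    using Suc by (simp add: ch power_add mult_ac)
  finally show ?case .
qed

lemma qpoch_neg_power_eq_0:
  assumes "q \<noteq> 0" "N < m"
  shows "qpoch (inverse (q ^ N)) q m = 0"
  using assms by (auto simp: qpoch_def intro!: bexI[of _ N])

section \<open>Gaussian binomials and the Saalschuetz sum\<close>

text \<open>The Gaussian binomial coefficient. The value 0 for k > n lets both Pascal rules hold
  without side conditions, also where \<open>n - k\<close> is truncated.\<close>

definition qbin :: "complex \<Rightarrow> nat \<Rightarrow> nat \<Rightarrow> complex" where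
  "qbin q n k = (if k \<le> n then qpoch q q n / (qpoch q q k * qpoch q q (n - k)) else 0)"

lemma qbin_0 [simp]: "norm q < 1 \<Longrightarrow> qbin q n 0 = 1"
  by (simp add: qbin_def qpoch_self_nonzero)

lemma qbin_self [simp]: "norm q < 1 \<Longrightarrow> qbin q n n = 1"
  by (simp add: qbin_def qpoch_self_nonzero)

lemma qbin_Suc_Suc:
  assumes "norm q < 1"
  shows "qbin q (Suc n) (Suc k) = q ^ Suc k * qbin q n (Suc k) + qbin q n k"
    and "qbin q (Suc n) (Suc k) = qbin q n (Suc k) + q ^ (n - k) * qbin q n k"
proof -
  consider "n < k" | "n = k" | r where "n = Suc (k + r)"
    by (metis less_imp_Suc_add linorder_neqE_nat)
  then have "qbin q (Suc n) (Suc k) = q ^ Suc k * qbin q n (Suc k) + qbin q n k \<and>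
      qbin q (Suc n) (Suc k) = qbin q n (Suc k) + q ^ (n - k) * qbin q n k"
  proof cases
    case 1
    then show ?thesis by (simp add: qbin_def)
  next
    case 2
    then show ?thesis using assms by simp (simp add: qbin_def)
  next
    case (3 r)
    have nz: "qpoch q q j \<noteq> 0" for j by (rule qpoch_self_nonzero[OF assms])
    have nz1: "1 - q * q ^ j \<noteq> 0" for j
      using power_neq_1[OF assms, of "Suc j"] by simp
    have d: "Suc (k + r) - k = Suc r" by simp
    have e: "qbin q (Suc n) (Suc k) =
        qpoch q q n * (1 - q * q ^ n) / (qpoch q q k * (1 - q * q ^ k) * (qpoch q q r * (1 - q * q ^ r)))"
      "qbin q n (Suc k) = qpoch q q n / (qpoch q q k * (1 - q * q ^ k) * qpoch q q r)"
      "qbin q n k = qpoch q q n / (qpoch q q k * (qpoch q q r * (1 - q * q ^ r)))"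
      "q ^ (n - k) = q * q ^ r" "q * q ^ n = q * q * q ^ k * q ^ r"
      by (simp_all add: qbin_def 3 d qpoch_Suc power_add)
    show ?thesis unfolding e using nz[of k] nz[of r] nz1[of k] nz1[of r]
      by (simp add: divide_simps) (simp add: algebra_simps)
  qed
  then show "qbin q (Suc n) (Suc k) = q ^ Suc k * qbin q n (Suc k) + qbin q n k"
    "qbin q (Suc n) (Suc k) = qbin q n (Suc k) + q ^ (n - k) * qbin q n k" by auto
qed

text \<open>
  This is the \<open>q\<close>-Pfaff--Saalschuetz sum cleared of denominators. Replacing \<open>e\<close> by \<open>e q\<close> makes the
  difference of the two sides telescope, by the two forms of Pascal's rule.
\<close>

lemma q_saalschuetz:
  assumes "norm q < 1"
  shows "(\<Sum>j\<le>M. qbin q M j * qpoch B q j * qpoch C q j * qpoch e q (M - j) * e ^ j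
            * qpoch (B * C * e * q ^ j) q (M - j))
         = qpoch (B * e) q M * qpoch (C * e) q M"
proof (induction M arbitrary: e)
  case 0
  then show ?case using assms by simp
next
  case (Suc M)
  \<comment> \<open>The common part of two summands: the one for \<open>Suc M\<close> and
    \<open>e\<close> is \<open>u j\<close> times a binomial and linear factors (\<open>T\<close>),
    the one for \<open>M\<close> and \<open>e * q\<close> is \<open>u j\<close> times a binomial and
    \<open>q ^ j\<close> (\<open>S\<close>).\<close>
  define u where "u j = qpoch B q j * qpoch C q j * qpoch (e * q) q (M - j) * e ^ j
            * qpoch (B * C * e * q ^ Suc j) q (M - j)" for j
  \<comment> \<open>The telescoping certificate. It vanishes at 0, and \<open>G (Suc M)\<close> is
    the summand with j = Suc M, so the boundary term of the telescoping sum over j <= M cancels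
    exactly the summand left out.\<close>
  define G where "G j = (case j of 0 \<Rightarrow> 0 | Suc i \<Rightarrow>
      qbin q M i * qpoch B q j * qpoch C q j * e ^ j * qpoch (e * q) q (M - i)
       * qpoch (B * C * e * q ^ j) q (M - i))" for j
  have GS: "G (Suc j) = qbin q M j * (1 - B * q ^ j) * (1 - C * q ^ j) * e * u j" for j
    by (simp add: G_def u_def qpoch_Suc mult_ac)
  have G0: "G j = (if j = 0 then 0 else qbin q M (j - 1)) * (1 - e * q ^ (Suc M - j))
      * (1 - B * C * e * q ^ j) * u j" if "j \<le> M" for j
  proof (cases j)
    case 0
    then show ?thesis by (simp add: G_def)
  next
    case (Suc i)
    with that have "M - i = Suc (M - j)" "Suc M - j = Suc (M - j)" by simp_all
    moreover have "qpoch (B * C * e * q ^ j) q (Suc (M - j))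
        = (1 - B * C * e * q ^ j) * qpoch (B * C * e * q ^ Suc j) q (M - j)"
      using qpoch_Suc_shift[of "B * C * e * q ^ j" q "M - j"] by (simp add: mult_ac)
    moreover have "qpoch (e * q) q (Suc (M - j)) = (1 - e * q ^ Suc (M - j)) * qpoch (e * q) q (M - j)"
      by (simp add: qpoch_Suc mult_ac)
    ultimately show ?thesis by (simp add: G_def u_def Suc del: power_Suc)
  qed
  have T: "qbin q (Suc M) j * qpoch B q j * qpoch C q j * qpoch e q (Suc M - j) * e ^ j
            * qpoch (B * C * e * q ^ j) q (Suc M - j)
      = qbin q (Suc M) j * (1 - e) * (1 - B * C * e * q ^ j) * u j" if "j \<le> M" for j
  proof -
    have s: "Suc M - j = Suc (M - j)" using that by simp
    show ?thesis unfolding s qpoch_Suc_shift[of e] qpoch_Suc_shift[of "B * C * e * q ^ j"] u_def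
      by (simp add: mult_ac)
  qed
  have key: "qbin q (Suc M) j * (1 - e) * (1 - B * C * e * q ^ j) * u j
      - (1 - B * e) * (1 - C * e) * (qbin q M j * q ^ j * u j) = G j - G (Suc j)"
    if "j \<le> M" for j
  proof -
    define g where "g = (if j = 0 then 0 else qbin q M (j - 1))"
    define y where "y = q ^ (Suc M - j)"
    define X where "X = q ^ j"
    define b where "b = qbin q M j"
    have p1: "qbin q (Suc M) j = X * b + g"
      and p2: "qbin q (Suc M) j = b + y * g"
    proof -
      show "qbin q (Suc M) j = X * b + g"
        using qbin_Suc_Suc(1)[OF assms, of M "j - 1"] assms
        by (cases j) (simp_all add: g_def X_def b_def)
      show "qbin q (Suc M) j = b + y * g"
        using qbin_Suc_Suc(2)[OF assms, of M "j - 1"] assms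
        by (cases j) (simp_all add: g_def y_def b_def)
    qed
    \<comment> \<open>The first Pascal rule is used on the part without \<open>e\<close>, the second
      on the part with \<open>e\<close>. Then \<open>b\<close>, \<open>g\<close>, \<open>X\<close>,
      \<open>y\<close> can be treated as independent variables, and the claim is a polynomial
      identity.\<close>
    have "qbin q (Suc M) j * (1 - e) = qbin q (Suc M) j - e * qbin q (Suc M) j"
      by (simp add: algebra_simps)
    also have "\<dots> = X * b + g - e * (b + y * g)"
      by (rule arg_cong2[where f = "\<lambda>x y. x - e * y", OF p1 p2])
    finally show ?thesis
      unfolding GS G0[OF that] g_def[symmetric] y_def[symmetric] X_def[symmetric] b_def[symmetric]
      by (simp only:) (simp add: algebra_simps)
  qed
  have S: "(\<Sum>j\<le>M. qbin q M j * q ^ j * u j) = qpoch (B * e * q) q M * qpoch (C * e * q) q M"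
  proof -
    have "(\<Sum>j\<le>M. qbin q M j * q ^ j * u j) =
      (\<Sum>j\<le>M. qbin q M j * qpoch B q j * qpoch C q j * qpoch (e * q) q (M - j) * (e * q) ^ j
            * qpoch (B * C * (e * q) * q ^ j) q (M - j))"
      by (intro sum.cong refl) (simp add: u_def power_mult_distrib mult_ac)
    also have "\<dots> = qpoch (B * (e * q)) q M * qpoch (C * (e * q)) q M" by (rule Suc.IH)
    finally show ?thesis by (simp add: mult_ac)
  qed
  have "(\<Sum>j\<le>M. qbin q (Suc M) j * (1 - e) * (1 - B * C * e * q ^ j) * u j)
      - (1 - B * e) * (1 - C * e) * (\<Sum>j\<le>M. qbin q M j * q ^ j * u j)
      = (\<Sum>j\<le>M. G j - G (Suc j))"
    unfolding sum_distrib_left sum_subtractf[symmetric] by (intro sum.cong refl key) simp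
  also have "\<dots> = - G (Suc M)" by (subst sum_telescope) (simp add: G_def)
  finally have E: "(\<Sum>j\<le>M. qbin q (Suc M) j * (1 - e) * (1 - B * C * e * q ^ j) * u j)
     = (1 - B * e) * (1 - C * e) * (qpoch (B * e * q) q M * qpoch (C * e * q) q M) - G (Suc M)"
    unfolding S by (simp add: algebra_simps)
  have "(\<Sum>j\<le>Suc M. qbin q (Suc M) j * qpoch B q j * qpoch C q j * qpoch e q (Suc M - j) * e ^ j
            * qpoch (B * C * e * q ^ j) q (Suc M - j))
      = (\<Sum>j\<le>M. qbin q (Suc M) j * (1 - e) * (1 - B * C * e * q ^ j) * u j) + G (Suc M)"
    unfolding sum.atMost_Suc using assms
    by (intro arg_cong2[where f = "(+)"] sum.cong refl T) (simp_all add: G_def)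
  then show ?case unfolding E by (simp add: qpoch_Suc_shift[of "B * e"] qpoch_Suc_shift[of "C * e"] mult_ac)
qed

section \<open>The Bailey matrix and Bailey's lemma\<close>

definition bailey_mat :: "complex \<Rightarrow> complex \<Rightarrow> nat \<Rightarrow> nat \<Rightarrow> complex" where
  "bailey_mat a q n m =
     (if m \<le> n then 1 / (qpoch q q (n - m) * qpoch (q * a) q (n + m)) else 0)"

text \<open>After n = m + j this is the Saalschuetz sum with parameters b q^m and c q^m. It is
  stated for one column of the matrix, so it acts on any Bailey pair by linearity. The only quantity
  required to be nonzero besides \<open>b\<close> and \<open>c\<close> is (qa)_{N+m}.\<close>

lemma bailey_lemma:
  assumes q: "norm q < 1" and nz: "b \<noteq> 0" "c \<noteq> 0"
    and e: "e = q * a / (b * c)" and m: "m \<le> N" and A: "qpoch (q * a) q (N + m) \<noteq> 0"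
  shows "(\<Sum>n\<le>N. qpoch b q n * qpoch c q n * e ^ n * qpoch e q (N - n) / qpoch q q (N - n)
            * bailey_mat a q n m)
         = qpoch b q m * qpoch c q m * e ^ m * qpoch (q * a / b * q ^ m) q (N - m)
            * qpoch (q * a / c * q ^ m) q (N - m) * bailey_mat a q N m"
proof -
  define M where "M = N - m"
  define B where "B = b * q ^ m"
  define C where "C = c * q ^ m"
  have N: "N = m + M" using m by (simp add: M_def)
  have nzq: "qpoch q q j \<noteq> 0" for j by (rule qpoch_self_nonzero[OF q])
  \<comment> \<open>Consequently the last Saalschuetz factor is the tail of (qa)_{N+m} after
    (qa)_{2m+j}, which brings all matrix entries of the column to one denominator.\<close>
  have BCe: "B * C * e = q * a * q ^ (m + m)"
    using nz by (simp add: B_def C_def e power_add)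
  have Be: "B * e = q * a / c * q ^ m" and Ce: "C * e = q * a / b * q ^ m"
    using nz by (simp_all add: B_def C_def e)
  define W where "W = qpoch b q m * qpoch c q m * e ^ m / (qpoch q q M * qpoch (q * a) q (N + m))"
  have T: "qpoch b q (m + j) * qpoch c q (m + j) * e ^ (m + j) * qpoch e q (N - (m + j))
        / qpoch q q (N - (m + j)) * bailey_mat a q (m + j) m
      = W * (qbin q M j * qpoch B q j * qpoch C q j * qpoch e q (M - j) * e ^ j
            * qpoch (B * C * e * q ^ j) q (M - j))" if "j \<le> M" for j
  proof -
    have "qpoch (q * a) q (N + m) = qpoch (q * a) q (m + j + m) * qpoch (B * C * e * q ^ j) q (M - j)"
    proof -
      have "B * C * e * q ^ j = q * a * q ^ (m + j + m)"
        unfolding BCe by (simp add: power_add)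
      moreover have "N + m = (m + j + m) + (M - j)" using that by (simp add: N)
      ultimately show ?thesis by (simp only: qpoch_add)
    qed
    moreover from this A have "qpoch (q * a) q (m + j + m) \<noteq> 0" "qpoch (B * C * e * q ^ j) q (M - j) \<noteq> 0"
      by auto
    ultimately show ?thesis using that nzq
      unfolding W_def bailey_mat_def qbin_def qpoch_add[of b] qpoch_add[of c] B_def[symmetric] C_def[symmetric]
      by (simp add: N power_add field_simps)
  qed
  have "(\<Sum>n\<le>N. qpoch b q n * qpoch c q n * e ^ n * qpoch e q (N - n) / qpoch q q (N - n)
            * bailey_mat a q n m)
    = (\<Sum>n=m..N. qpoch b q n * qpoch c q n * e ^ n * qpoch e q (N - n) / qpoch q q (N - n)
            * bailey_mat a q n m)"
    by (rule sum.mono_neutral_right) (auto simp: bailey_mat_def)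
  also have "\<dots> = (\<Sum>j\<le>M. qpoch b q (m + j) * qpoch c q (m + j) * e ^ (m + j) * qpoch e q (N - (m + j))
        / qpoch q q (N - (m + j)) * bailey_mat a q (m + j) m)"
    by (rule sum.reindex_bij_witness[of _ "\<lambda>j. m + j" "\<lambda>n. n - m"]) (auto simp: N)
  also have "\<dots> = W * (\<Sum>j\<le>M. qbin q M j * qpoch B q j * qpoch C q j * qpoch e q (M - j) * e ^ j
            * qpoch (B * C * e * q ^ j) q (M - j))"
    unfolding sum_distrib_left by (intro sum.cong refl T) simp
  also have "\<dots> = W * (qpoch (B * e) q M * qpoch (C * e) q M)"
    unfolding q_saalschuetz[OF q] ..
  finally show ?thesis unfolding Be Ce W_def bailey_mat_def M_def using m by (simp add: mult_ac)
qed

section \<open>The unit Bailey pair\<close>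

text \<open>\<open>(a)\<^sub>m (1 - a q\<^sup>2\<^sup>m) / (1 - a)\<close>, continued to \<open>a = 1\<close>.\<close>

definition vwp_weight :: "complex \<Rightarrow> complex \<Rightarrow> nat \<Rightarrow> complex" where
  "vwp_weight a q m = (case m of 0 \<Rightarrow> 1 | Suc i \<Rightarrow> qpoch (q * a) q i * (1 - a * q ^ (2 * m)))"

text \<open>The sum is indefinitely summable: every partial sum is a product, so induction on
  \<open>M\<close> works. Stopping before m = n keeps (q)_{n-M-1} meaningful.\<close>

lemma unit_bailey_pair_partial:
  assumes q: "norm q < 1" and A: "qpoch (q * a) q (n + M) \<noteq> 0" and M: "M < n"
  shows "(\<Sum>m\<le>M. vwp_weight a q m / qpoch q q m * (- 1) ^ m * q ^ (m choose 2) * bailey_mat a q n m)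
    = qpoch (q * a) q M * (- 1) ^ M * q ^ (Suc M choose 2)
       / (qpoch q q M * qpoch q q (n - Suc M) * qpoch (q * a) q (n + M) * (1 - q ^ n))"
  using A M
proof (induction M)
  case 0
  then have n: "n = Suc (n - 1)" by simp
  have "qpoch q q n = qpoch q q (n - Suc 0) * (1 - q ^ n)"
    using qpoch_Suc[of q q "n - 1"] n by (metis One_nat_def power_Suc)
  then show ?case by (simp add: vwp_weight_def bailey_mat_def numeral_2_eq_2)
next
  case (Suc M)
  obtain r where n: "n = Suc (Suc (M + r))"
    using Suc.prems(2) less_imp_Suc_add by (metis add_Suc)
  have nzq: "qpoch q q j \<noteq> 0" for j by (rule qpoch_self_nonzero[OF q])
  have nz1: "1 - q * q ^ j \<noteq> 0" for j
    using power_neq_1[OF q, of "Suc j"] by simp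
  have nzn: "1 - q ^ n \<noteq> 0" using power_neq_1[OF q, of n] n by simp
  have A: "qpoch (q * a) q (n + Suc M) = qpoch (q * a) q (n + M) * (1 - q * a * q ^ (n + M))"
    by (simp add: qpoch_Suc)
  with Suc.prems have nzA: "qpoch (q * a) q (n + M) \<noteq> 0" "1 - q * a * q ^ (n + M) \<noteq> 0" by auto
  have ch: "Suc (Suc M) choose 2 = Suc M + (Suc M choose 2)" by (simp add: numeral_2_eq_2)
  have d: "n - Suc M = Suc r" "n - Suc (Suc M) = r" by (simp_all add: n)
  have pn: "q ^ n = q * q * q ^ M * q ^ r" by (simp add: n power_add)
  have p: "q ^ (n + M) = q ^ n * q ^ M" "q ^ (2 * Suc M) = q * q * q ^ M * q ^ M"
    by (simp_all add: power_add mult_2)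
  have IH: "(\<Sum>m\<le>M. vwp_weight a q m / qpoch q q m * (- 1) ^ m * q ^ (m choose 2) * bailey_mat a q n m)
    = qpoch (q * a) q M * (- 1) ^ M * q ^ (Suc M choose 2)
       / (qpoch q q M * (qpoch q q r * (1 - q * q ^ r)) * qpoch (q * a) q (n + M) * (1 - q ^ n))"
    using Suc.IH[OF nzA(1)] Suc.prems by (simp add: d qpoch_Suc)
  have t: "vwp_weight a q (Suc M) / qpoch q q (Suc M) * (- 1) ^ Suc M * q ^ (Suc M choose 2)
       * bailey_mat a q n (Suc M)
     = - (qpoch (q * a) q M * (1 - a * (q * q * q ^ M * q ^ M)) * (- 1) ^ M * q ^ (Suc M choose 2))
       / (qpoch q q M * (1 - q * q ^ M) * (qpoch q q r * (1 - q * q ^ r))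
          * (qpoch (q * a) q (n + M) * (1 - q * a * (q ^ n * q ^ M))))"
    using Suc.prems(2) unfolding bailey_mat_def A vwp_weight_def p d by (simp add: qpoch_Suc p(2)[simplified])
  \<comment> \<open>The whole content of the induction step: over a common denominator, old partial
    sum plus new term has the left side in its numerator, and it factors.\<close>
  have alg: "- ((1 - q * q ^ M) * (1 - q * a * (q ^ n * q ^ M))) + (1 - a * (q * q * q ^ M * q ^ M)) * (1 - q ^ n)
     = q * q ^ M * (1 - q * q ^ r) * (1 - q * a * q ^ M)"
    unfolding pn by (simp add: algebra_simps)
  \<comment> \<open>The fractions are combined with letters for the factors, so that
    \<open>alg\<close> is the only relation between them.\<close>
  have gen: "X / (Q * (R * r1) * A * n1) + - (X * s') / (Q * u * (R * r1) * (A * v))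
      = - (X * x * t) / (Q * u * R * (A * v) * n1)"
    if "- (u * v) + s' * n1 = x * r1 * t"
      and "Q \<noteq> 0" "R \<noteq> 0" "r1 \<noteq> 0" "A \<noteq> 0" "n1 \<noteq> 0" "u \<noteq> 0" "v \<noteq> 0"
    for X Q R r1 A n1 s' u v x t :: complex
  proof -
    have "X / (Q * (R * r1) * A * n1) + - (X * s') / (Q * u * (R * r1) * (A * v))
      = - X * (- (u * v) + s' * n1) / (Q * u * (R * r1) * (A * v) * n1)"
      using that(2-) by (simp add: divide_simps) (simp add: algebra_simps)
    also have "\<dots> = - (X * x * t) / (Q * u * R * (A * v) * n1)"
      unfolding that(1) using that(2-) by (simp add: divide_simps)
    finally show ?thesis .
  qed
  have v: "1 - q * a * (q ^ n * q ^ M) \<noteq> 0" using nzA(2) by (simp add: p)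
  have "(\<Sum>m\<le>Suc M. vwp_weight a q m / qpoch q q m * (- 1) ^ m * q ^ (m choose 2) * bailey_mat a q n m)
    = - (qpoch (q * a) q M * (- 1) ^ M * q ^ (Suc M choose 2) * (q * q ^ M) * (1 - q * a * q ^ M))
       / (qpoch q q M * (1 - q * q ^ M) * qpoch q q r
          * (qpoch (q * a) q (n + M) * (1 - q * a * (q ^ n * q ^ M))) * (1 - q ^ n))"
    unfolding sum.atMost_Suc IH t
    using gen[OF alg nzq nzq nz1 nzA(1) nzn nz1 v,
        where X = "qpoch (q * a) q M * (- 1) ^ M * q ^ (Suc M choose 2)"]
    by (simp add: mult_ac)
  then show ?case
    unfolding A ch d p qpoch_Suc[of "q * a" q M] qpoch_Suc[of q q M]
    by (simp add: power_add mult_ac)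
qed

text \<open>For n > 0 the last term, m = n, is the negative of the partial sum up to n - 1.\<close>

lemma unit_bailey_pair:
  assumes q: "norm q < 1" and A: "qpoch (q * a) q (n + n) \<noteq> 0"
  shows "(\<Sum>m\<le>n. vwp_weight a q m / qpoch q q m * (- 1) ^ m * q ^ (m choose 2) * bailey_mat a q n m)
    = (if n = 0 then 1 else 0)"
proof (cases n)
  case 0
  then show ?thesis by (simp add: vwp_weight_def bailey_mat_def numeral_2_eq_2)
next
  case (Suc p)
  \<comment> \<open>The last factor of (qa)_{2n} is the very-well-poised factor of the weight at m =
    n, and the two cancel.\<close>
  have A': "qpoch (q * a) q (n + n) = qpoch (q * a) q (n + p) * (1 - a * q ^ (2 * Suc p))"
  proof -
    have "n + n = Suc (n + p)" "q * a * q ^ (n + p) = a * q ^ (2 * Suc p)"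
      by (simp_all add: Suc power_add mult_2)
    then show ?thesis by (simp only: qpoch_Suc)
  qed
  with A have nzA: "qpoch (q * a) q (n + p) \<noteq> 0" "1 - a * q ^ (2 * Suc p) \<noteq> 0" by auto
  have S: "qpoch q q (Suc p) = qpoch q q p * (1 - q ^ Suc p)" by (simp add: qpoch_Suc)
  have nzq: "qpoch q q j \<noteq> 0" for j by (rule qpoch_self_nonzero[OF q])
  have nz1: "1 - q ^ Suc p \<noteq> 0" using power_neq_1[OF q, of "Suc p"] by simp
  have t: "vwp_weight a q (Suc p) / qpoch q q (Suc p) * (- 1) ^ Suc p * q ^ (Suc p choose 2)
       * bailey_mat a q n (Suc p)
    = - (qpoch (q * a) q p * (- 1) ^ p * q ^ (Suc p choose 2)
       / (qpoch q q p * qpoch q q (n - Suc p) * qpoch (q * a) q (n + p) * (1 - q ^ n)))"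
  proof -
    have "bailey_mat a q n (Suc p) = 1 / (qpoch (q * a) q (n + p) * (1 - a * q ^ (2 * Suc p)))"
      using A' by (simp add: bailey_mat_def Suc)
    then show ?thesis unfolding vwp_weight_def S
      using nzA(2) by (simp add: Suc mult.assoc)
  qed
  have "{..n} = {..Suc p}" by (simp add: Suc)
  then have "(\<Sum>m\<le>n. vwp_weight a q m / qpoch q q m * (- 1) ^ m * q ^ (m choose 2) * bailey_mat a q n m) = 0"
    using unit_bailey_pair_partial[OF q nzA(1)] t by (simp add: Suc)
  then show ?thesis by (simp add: Suc)
qed

section \<open>The terminating 6-phi-5 sum\<close>

text \<open>The part of the 6-phi-5 term that does not depend on n, l, k. Rewriting (q^-n)_m,
  (q^-l)_m, (q^-k)_m by Bailey matrix entries yields (-1)^m q^(m choose 2) three times, with total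
  sign (-1)^m; (qa)^m is left from the argument a q^(n+l+k+1).\<close>

definition vwp_coeff :: "complex \<Rightarrow> complex \<Rightarrow> nat \<Rightarrow> complex" where
  "vwp_coeff a q m = vwp_weight a q m / qpoch q q m * (- 1) ^ m * q ^ (m choose 2)
     * (q ^ (m choose 2))\<^sup>2 * (q * a) ^ m"

text \<open>Bailey's lemma at level \<open>n\<close> with b = q^-l and c = q^-k. Since the unit pair
  has beta_j = 0 for j > 0, the sum over \<open>j\<close> collapses to (e)_n / (q)_n with e = a
  q^(l+k+1), the missing tail of (qa)_{n+l+k}.\<close>

lemma six_phi_five:
  assumes q: "q \<noteq> 0" "norm q < 1"
    and A: "qpoch (q * a) q (n + l) \<noteq> 0" "qpoch (q * a) q (n + k) \<noteq> 0" "qpoch (q * a) q (l + k) \<noteq> 0"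
  shows "(\<Sum>m\<le>n. vwp_coeff a q m * bailey_mat a q n m * bailey_mat a q l m * bailey_mat a q k m)
    = qpoch (q * a) q (n + l + k) / (qpoch q q n * qpoch q q l * qpoch q q k
        * (qpoch (q * a) q (n + l) * qpoch (q * a) q (n + k) * qpoch (q * a) q (l + k)))"
proof -
  define b c where "b = inverse (q ^ l)" and "c = inverse (q ^ k)"
  define e where "e = q * a / (b * c)"
  define U where "U m = vwp_weight a q m / qpoch q q m * (- 1) ^ m * q ^ (m choose 2)" for m
  define F where "F j = qpoch b q j * qpoch c q j * e ^ j * qpoch e q (n - j) / qpoch q q (n - j)" for j
  have e': "e = q * a * q ^ (l + k)" by (simp add: e_def b_def c_def power_add field_simps)
  have bc: "b \<noteq> 0" "c \<noteq> 0" using q by (simp_all add: b_def c_def)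
  have nzq: "qpoch q q j \<noteq> 0" for j by (rule qpoch_self_nonzero[OF q(2)])
  have F0: "F j = 0" if "l < j \<or> k < j" for j
    using that qpoch_neg_power_eq_0[OF q(1)] by (auto simp: F_def b_def c_def)
  \<comment> \<open>The unit pair needs (qa)_{2j} nonzero, which follows from \<open>A\<close> only
    for small \<open>j\<close>. For j > l or j > k the factor \<open>F j\<close> is zero; otherwise
    2j <= n + l.\<close>
  have unit: "F j * (\<Sum>m\<le>n. U m * bailey_mat a q j m) = F j * (if j = 0 then 1 else 0)" if "j \<le> n" for j
  proof (cases "l < j \<or> k < j")
    case True
    then show ?thesis using F0 by simp
  next
    case False
    have "(\<Sum>m\<le>n. U m * bailey_mat a q j m) = (\<Sum>m\<le>j. U m * bailey_mat a q j m)"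
      using that by (intro sum.mono_neutral_right) (auto simp: bailey_mat_def)
    also have "\<dots> = (if j = 0 then 1 else 0)"
      unfolding U_def using False that
      by (intro unit_bailey_pair[OF q(2)] qpoch_nonzero_mono[OF A(1)]) auto
    finally show ?thesis by simp
  qed
  have inner: "(\<Sum>j\<le>n. F j * bailey_mat a q j m) = qpoch q q l * qpoch q q k * qpoch (q * a) q (n + l)
       * qpoch (q * a) q (n + k) * ((q ^ (m choose 2))\<^sup>2 * (q * a) ^ m)
       * (bailey_mat a q n m * bailey_mat a q l m * bailey_mat a q k m)"
    if "m \<le> n" for m
  proof (cases "l < m \<or> k < m")
    case True
    then have "F j * bailey_mat a q j m = 0" for j
      using F0[of j] by (cases "m \<le> j") (auto simp: bailey_mat_def)
    moreover have "bailey_mat a q l m * bailey_mat a q k m = 0"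
      using True by (auto simp: bailey_mat_def)
    ultimately show ?thesis by (auto simp: mult.assoc intro!: sum.neutral)
  next
    case False
    then have m: "m \<le> l" "m \<le> k" by auto
    \<comment> \<open>The roles of \<open>b\<close> and \<open>c\<close> are alike: each parameter
      q^-r turns its numerator and its tail into the matrix entry for \<open>r\<close>. The two
      signs cancel, and the two powers of \<open>q\<close> form the square in
      \<open>vwp_coeff\<close>.\<close>
    have red: "qpoch (inverse (q ^ r)) q m * qpoch (q * a / inverse (q ^ r) * q ^ m) q (n - m) * (q ^ r) ^ m
       = (- 1) ^ m * q ^ (m choose 2) * qpoch q q r * qpoch (q * a) q (n + r) * bailey_mat a q r m"
      if r: "m \<le> r" and Ar: "qpoch (q * a) q (n + r) \<noteq> 0" for r
    proof -
      have "qpoch (q * a) q (n + r) = qpoch (q * a) q (r + m) * qpoch (q * a / inverse (q ^ r) * q ^ m) q (n - m)"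
        using qpoch_add[of "q * a" q "r + m" "n - m"] \<open>m \<le> n\<close>
        by (simp add: power_add field_simps)
      moreover from this Ar have "qpoch (q * a) q (r + m) \<noteq> 0" by auto
      ultimately have tail: "qpoch (q * a / inverse (q ^ r) * q ^ m) q (n - m)
          = qpoch (q * a) q (n + r) / qpoch (q * a) q (r + m)"
        by simp
      have head: "qpoch (inverse (q ^ r)) q m * (q ^ r) ^ m
          = (- 1) ^ m * q ^ (m choose 2) * qpoch q q r / qpoch q q (r - m)"
        using qpoch_neg_power[OF q(1) r, unfolded power_mult] nzq[of "r - m"]
        by (simp add: nonzero_eq_divide_eq mult_ac)
      have "qpoch (inverse (q ^ r)) q m * qpoch (q * a / inverse (q ^ r) * q ^ m) q (n - m) * (q ^ r) ^ m
        = (qpoch (inverse (q ^ r)) q m * (q ^ r) ^ m) * qpoch (q * a / inverse (q ^ r) * q ^ m) q (n - m)"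
        by (simp only: mult_ac)
      then show ?thesis unfolding head tail using r by (simp add: bailey_mat_def)
    qed
    have em: "e ^ m = (q * a) ^ m * (q ^ l) ^ m * (q ^ k) ^ m"
      by (simp add: e' power_add power_mult_distrib mult_ac)
    have "(\<Sum>j\<le>n. F j * bailey_mat a q j m)
       = qpoch b q m * qpoch c q m * e ^ m * qpoch (q * a / b * q ^ m) q (n - m)
            * qpoch (q * a / c * q ^ m) q (n - m) * bailey_mat a q n m"
      unfolding F_def using m \<open>m \<le> n\<close>
      by (intro bailey_lemma[OF q(2) bc e_def] qpoch_nonzero_mono[OF A(1)]) auto
    also have "\<dots> = (qpoch b q m * qpoch (q * a / b * q ^ m) q (n - m) * (q ^ l) ^ m)
       * (qpoch c q m * qpoch (q * a / c * q ^ m) q (n - m) * (q ^ k) ^ m) * (q * a) ^ m * bailey_mat a q n m"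
      unfolding em by (simp only: mult_ac)
    also have "\<dots> = ((- 1) ^ m * (- 1) ^ m) * (qpoch q q l * qpoch q q k * qpoch (q * a) q (n + l)
       * qpoch (q * a) q (n + k) * ((q ^ (m choose 2))\<^sup>2 * (q * a) ^ m)
       * (bailey_mat a q n m * bailey_mat a q l m * bailey_mat a q k m))"
      unfolding b_def c_def red[OF m(1) A(1)] red[OF m(2) A(2)]
      by (simp only: power2_eq_square mult_ac)
    also have "(- 1) ^ m * (- 1) ^ m = (1 :: complex)"
      by (simp flip: power_mult_distrib)
    finally show ?thesis by simp
  qed
  have "qpoch e q n / qpoch q q n = (\<Sum>j\<le>n. F j * (if j = 0 then 1 else 0))"
    by (simp add: F_def if_distrib cong: if_cong)
  also have "\<dots> = (\<Sum>j\<le>n. F j * (\<Sum>m\<le>n. U m * bailey_mat a q j m))"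
    by (intro sum.cong refl unit[symmetric]) simp
  also have "\<dots> = (\<Sum>m\<le>n. \<Sum>j\<le>n. U m * (F j * bailey_mat a q j m))"
    unfolding sum_distrib_left by (subst sum.swap) (simp only: mult_ac)
  also have "\<dots> = (\<Sum>m\<le>n. qpoch q q l * qpoch q q k * qpoch (q * a) q (n + l) * qpoch (q * a) q (n + k)
       * (vwp_coeff a q m * bailey_mat a q n m * bailey_mat a q l m * bailey_mat a q k m))"
    unfolding sum_distrib_left[symmetric, of "U _"]
    by (intro sum.cong refl, subst inner) (simp_all add: U_def vwp_coeff_def)
  also have "\<dots> = qpoch q q l * qpoch q q k * qpoch (q * a) q (n + l) * qpoch (q * a) q (n + k)
       * (\<Sum>m\<le>n. vwp_coeff a q m * bailey_mat a q n m * bailey_mat a q l m * bailey_mat a q k m)"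
    by (rule sum_distrib_left[symmetric])
  finally have main: "qpoch e q n / qpoch q q n = \<dots>" .
  have "qpoch (q * a) q (n + l + k) = qpoch (q * a) q (l + k) * qpoch e q n"
    using qpoch_add[of "q * a" q "l + k" n] by (simp add: e' add_ac)
  then show ?thesis using main A nzq by (simp add: field_simps)
qed

section \<open>Bailey's lemma in the notation of the triple sum\<close>

text \<open>Reversal of the order of the factors, with x = q^(1-N) / e. For e = qa/(bc) this
  \<open>x\<close> is bc q^-N / a, the lower parameter in the triple sum.\<close>

lemma qpoch_reverse_ratio:
  assumes q: "q \<noteq> 0" "norm q < 1" and e: "e \<noteq> 0" and x: "x * (e * q ^ N) = q"
    and n: "n \<le> N" and nz: "qpoch e q N \<noteq> 0" "qpoch x q n \<noteq> 0"
  shows "e ^ n * qpoch e q (N - n) / qpoch q q (N - n)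
    = qpoch e q N / qpoch q q N * (qpoch (inverse (q ^ N)) q n * q ^ n / qpoch x q n)"
  using n nz(2)
proof (induction n)
  case 0
  then show ?case by simp
next
  case (Suc n)
  have nzq: "qpoch q q j \<noteq> 0" for j by (rule qpoch_self_nonzero[OF q(2)])
  have nz1: "1 - q * q ^ j \<noteq> 0" for j
    using power_neq_1[OF q(2), of "Suc j"] by simp
  define r where "r = N - Suc n"
  have N: "N = Suc (n + r)" and d: "N - n = Suc r" "N - Suc n = r"
    using Suc.prems by (simp_all add: r_def)
  have pN: "q ^ N = q * q ^ n * q ^ r" by (simp add: N power_add)
  have x': "x = 1 / (e * q ^ n * q ^ r)" using x e q(1) by (simp add: pN field_simps)
  have nzx: "qpoch x q n \<noteq> 0" "1 - x * q ^ n \<noteq> 0"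
    using Suc.prems(2) by (auto simp: qpoch_Suc)
  have nze: "1 - e * q ^ r \<noteq> 0"
    using qpoch_nonzero_mono[OF nz(1), of "Suc r"] by (simp add: N qpoch_Suc)
  have step: "e * (1 - q * q ^ r) * (1 - x * q ^ n) = (1 - inverse (q ^ N) * q ^ n) * q * (1 - e * q ^ r)"
    unfolding x' pN using e q(1) by (simp add: field_simps)
  have "e ^ Suc n * qpoch e q (N - Suc n) / qpoch q q (N - Suc n)
     = e ^ n * qpoch e q (N - n) / qpoch q q (N - n) * (e * (1 - q * q ^ r) / (1 - e * q ^ r))"
  proof -
    have "e ^ Suc n * x / y = e ^ n * (x * u) / (y * v) * (e * v / u)"
      if "u \<noteq> 0" "v \<noteq> 0" for x y u v
      using that by simp
    from this[OF nze nz1] show ?thesis unfolding d qpoch_Suc .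
  qed
  also have "e * (1 - q * q ^ r) / (1 - e * q ^ r) = (1 - inverse (q ^ N) * q ^ n) * q / (1 - x * q ^ n)"
    using step nze nzx(2) by (simp add: frac_eq_eq)
  also have "e ^ n * qpoch e q (N - n) / qpoch q q (N - n)
    = qpoch e q N / qpoch q q N * (qpoch (inverse (q ^ N)) q n * q ^ n / qpoch x q n)"
    using Suc.IH Suc.prems(1) nzx(1) by simp
  finally show ?case by (simp add: qpoch_Suc mult_ac)
qed

text \<open>The right side is the prefactor of the theorem, the share of one triple in the 12-W-11
  term, and an elementary factor. The third parameter \<open>Q\<close> enters through (qa)_{N+m} =
  (qa)_N (qa/Q)_m and through (q)_N / (q)_{N-m}. The factor 1/(q)_n of the triple sum is absent
  because the 6-phi-5 kernel supplies (q)_n.\<close>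

lemma bailey_lemma_reversed:
  fixes a b c q :: complex and N m :: nat
  defines "Q \<equiv> inverse (q ^ N)"
  assumes q: "q \<noteq> 0" "norm q < 1" and nz: "a \<noteq> 0" "b \<noteq> 0" "c \<noteq> 0"
    and m: "m \<le> N" and A: "qpoch (q * a) q (N + m) \<noteq> 0"
    and B: "qpoch (q * a / b) q m \<noteq> 0" and C: "qpoch (q * a / c) q m \<noteq> 0"
    and E: "qpoch (q * a / (b * c)) q N \<noteq> 0" and X: "qpoch (b * c * Q / a) q N \<noteq> 0"
  shows "(\<Sum>n\<le>N. qpoch b q n * qpoch c q n * qpoch Q q n * q ^ n / qpoch (b * c * Q / a) q n
            * bailey_mat a q n m)
    = qpoch (q * a / b) q N * qpoch (q * a / c) q N / (qpoch (q * a) q N * qpoch (q * a / (b * c)) q N)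
       * (qpoch b q m * qpoch c q m * qpoch Q q m
          / (qpoch (q * a / b) q m * qpoch (q * a / c) q m * qpoch (q * a / Q) q m))
       * ((q * a / (b * c)) ^ m * (- 1) ^ m * q ^ (N * m) / q ^ (m choose 2))"
proof -
  define e where "e = q * a / (b * c)"
  have nzq: "qpoch q q j \<noteq> 0" for j by (rule qpoch_self_nonzero[OF q(2)])
  have e0: "e \<noteq> 0" using q nz by (simp add: e_def)
  have E': "qpoch e q N \<noteq> 0" using E by (simp add: e_def)
  have x: "b * c * Q / a * (e * q ^ N) = q" using q nz by (simp add: e_def Q_def field_simps)
  have T: "qpoch b q n * qpoch c q n * qpoch Q q n * q ^ n / qpoch (b * c * Q / a) q n * bailey_mat a q n m
     = qpoch q q N / qpoch e q N * (qpoch b q n * qpoch c q n * e ^ n * qpoch e q (N - n) / qpoch q q (N - n)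
            * bailey_mat a q n m)" if "n \<le> N" for n
  proof -
    have "e ^ n * qpoch e q (N - n) / qpoch q q (N - n)
      = qpoch e q N / qpoch q q N * (qpoch Q q n * q ^ n / qpoch (b * c * Q / a) q n)"
      unfolding Q_def
      using qpoch_reverse_ratio[OF q e0 x that E' qpoch_nonzero_mono[OF X that]] by (simp add: Q_def)
    then have "qpoch Q q n * q ^ n / qpoch (b * c * Q / a) q n
      = qpoch q q N / qpoch e q N * (e ^ n * qpoch e q (N - n) / qpoch q q (N - n))"
      using nzq E' by simp
    then have "qpoch b q n * qpoch c q n * (qpoch Q q n * q ^ n / qpoch (b * c * Q / a) q n) * bailey_mat a q n m
      = qpoch b q n * qpoch c q n * (qpoch q q N / qpoch e q N * (e ^ n * qpoch e q (N - n) / qpoch q q (N - n)))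
         * bailey_mat a q n m"
      by (simp only:)
    then show ?thesis by (simp add: mult_ac)
  qed
  have AN: "qpoch (q * a) q (N + m) = qpoch (q * a) q N * qpoch (q * a / Q) q m"
    by (simp add: qpoch_add Q_def divide_inverse)
  have Qm: "qpoch Q q m * (q ^ (N * m) * (- 1) ^ m) / q ^ (m choose 2) = qpoch q q N / qpoch q q (N - m)"
  proof -
    have "(- 1) ^ m * (- 1) ^ m = (1 :: complex)"
      by (simp flip: power_mult_distrib)
    then have "qpoch Q q m * qpoch q q (N - m) * q ^ (N * m) * (- 1) ^ m = q ^ (m choose 2) * qpoch q q N"
      using qpoch_neg_power[OF q(1) m] by (simp add: Q_def mult_ac)
    then show ?thesis using nzq[of "N - m"] q(1) by (simp add: field_simps)
  qed
  have "(\<Sum>n\<le>N. qpoch b q n * qpoch c q n * qpoch Q q n * q ^ n / qpoch (b * c * Q / a) q n * bailey_mat a q n m)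
    = qpoch q q N / qpoch e q N * (\<Sum>n\<le>N. qpoch b q n * qpoch c q n * e ^ n * qpoch e q (N - n)
            / qpoch q q (N - n) * bailey_mat a q n m)"
    unfolding sum_distrib_left by (intro sum.cong refl T) simp
  also have "\<dots> = qpoch q q N / qpoch e q N * (qpoch b q m * qpoch c q m * e ^ m
            * qpoch (q * a / b * q ^ m) q (N - m)
            * qpoch (q * a / c * q ^ m) q (N - m) * bailey_mat a q N m)"
    using bailey_lemma[OF q(2) nz(2,3) e_def m A] by simp
  also have "\<dots> = qpoch (q * a / b) q N * qpoch (q * a / c) q N / (qpoch (q * a) q N * qpoch e q N)
       * (qpoch b q m * qpoch c q m / (qpoch (q * a / b) q m * qpoch (q * a / c) q m * qpoch (q * a / Q) q m))
       * e ^ m * (qpoch q q N / qpoch q q (N - m))"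
    using m B C unfolding bailey_mat_def AN qpoch_split[OF m, of "q * a / b"] qpoch_split[OF m, of "q * a / c"]
    by (simp add: mult_ac)
  also have "\<dots> = qpoch (q * a / b) q N * qpoch (q * a / c) q N / (qpoch (q * a) q N * qpoch e q N)
       * (qpoch b q m * qpoch c q m * qpoch Q q m
          / (qpoch (q * a / b) q m * qpoch (q * a / c) q m * qpoch (q * a / Q) q m))
       * (e ^ m * (- 1) ^ m * q ^ (N * m) / q ^ (m choose 2))"
    unfolding Qm[symmetric] by (simp add: mult_ac)
  finally show ?thesis unfolding e_def .
qed

section \<open>Assembly of the transformation\<close>

text \<open>(qs)_m / (s)_m telescopes to (1 - s q^m) / (1 - s), likewise for -s, and the product 1 -
  a of the two denominators cancels the first factor of (a)_m. For m > 0 the hypotheses force a to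
  differ from 1.\<close>

lemma vwp_weight_eq:
  assumes s: "s * s = a" and nz: "qpoch s q m \<noteq> 0" "qpoch (- s) q m \<noteq> 0"
  shows "qpoch a q m * qpoch (q * s) q m * qpoch (- (q * s)) q m / (qpoch s q m * qpoch (- s) q m)
    = vwp_weight a q m"
proof (cases m)
  case 0
  then show ?thesis by (simp add: vwp_weight_def)
next
  case (Suc i)
  have "1 - s \<noteq> 0" "1 + s \<noteq> 0" using nz by (auto simp: Suc qpoch_Suc_shift)
  moreover have "(1 - s) * qpoch (q * s) q m = qpoch s q m * (1 - s * q ^ m)"
    "(1 + s) * qpoch (- (q * s)) q m = qpoch (- s) q m * (1 + s * q ^ m)"
    using qpoch_Suc[of s q m] qpoch_Suc_shift[of s q m] qpoch_Suc[of "- s" q m] qpoch_Suc_shift[of "- s" q m]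
    by (simp_all add: mult.commute)
  ultimately have e: "qpoch (q * s) q m = qpoch s q m * (1 - s * q ^ m) / (1 - s)"
    "qpoch (- (q * s)) q m = qpoch (- s) q m * (1 + s * q ^ m) / (1 + s)"
    by (simp_all add: field_simps)
  have a: "qpoch a q m = (1 - s) * (1 + s) * qpoch (q * a) q i"
    using qpoch_Suc_shift[of a q i] by (simp add: Suc s[symmetric] algebra_simps)
  have w: "1 - a * q ^ (2 * m) = (1 - s * q ^ m) * (1 + s * q ^ m)"
  proof -
    have "q ^ (2 * m) = q ^ m * q ^ m" by (simp add: mult_2 power_add)
    then show ?thesis by (simp only: s[symmetric]) (simp add: algebra_simps)
  qed
  have "vwp_weight a q m = qpoch (q * a) q i * (1 - a * q ^ (2 * m))"
    by (simp add: vwp_weight_def Suc)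
  then show ?thesis unfolding w e a using nz \<open>1 - s \<noteq> 0\<close> \<open>1 + s \<noteq> 0\<close> by simp
qed

theorem mainTheorem6:
  fixes N L K :: nat
    and q a b c b' c' b'' c'' :: complex
  assumes nonzero: "q \<noteq> 0" "a \<noteq> 0" "b \<noteq> 0" "c \<noteq> 0" "b' \<noteq> 0" "c' \<noteq> 0" "b'' \<noteq> 0" "c'' \<noteq> 0"
    and q_less: "norm q < 1"
    and den_mixed: "\<And>n l k. n \<le> N \<Longrightarrow> l \<le> L \<Longrightarrow> k \<le> K \<Longrightarrow>
          qpoch (q * a) q (n + l) * qpoch (q * a) q (n + k) * qpoch (q * a) q (l + k) \<noteq> 0"
    and den_n: "\<And>n. n \<le> N \<Longrightarrow> qpochs [q, b * c * q powi (- int N) / a] q n \<noteq> 0"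
    and den_l: "\<And>l. l \<le> L \<Longrightarrow> qpochs [q, b' * c' * q powi (- int L) / a] q l \<noteq> 0"
    and den_k: "\<And>k. k \<le> K \<Longrightarrow> qpochs [q, b'' * c'' * q powi (- int K) / a] q k \<noteq> 0"
    and den_N: "qpochs [q * a, q * a / (b * c)] q N \<noteq> 0"
    and den_L: "qpochs [q * a, q * a / (b' * c')] q L \<noteq> 0"
    and den_K: "qpochs [q * a, q * a / (b'' * c'')] q K \<noteq> 0"
    and den_W: "\<And>m. m \<le> min N (min L K) \<Longrightarrow>
          vwp_den a [b, c, b', c', b'', c'',
            q powi (- int N), q powi (- int L), q powi (- int K)] q m \<noteq> 0"
  shows
    "(\<Sum>n=0..N. \<Sum>l=0..L. \<Sum>k=0..K.
        qpoch (q * a) q (n + l + k)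
          / (qpoch (q * a) q (n + l) * qpoch (q * a) q (n + k) * qpoch (q * a) q (l + k))
        * (qpochs [b, c, q powi (- int N)] q n / qpochs [q, b * c * q powi (- int N) / a] q n)
        * (qpochs [b', c', q powi (- int L)] q l / qpochs [q, b' * c' * q powi (- int L) / a] q l)
        * (qpochs [b'', c'', q powi (- int K)] q k / qpochs [q, b'' * c'' * q powi (- int K) / a] q k)
        * q ^ (n + l + k))
     = qpochs [q * a / b, q * a / c] q N / qpochs [q * a, q * a / (b * c)] q N
       * (qpochs [q * a / b', q * a / c'] q L / qpochs [q * a, q * a / (b' * c')] q L)
       * (qpochs [q * a / b'', q * a / c''] q K / qpochs [q * a, q * a / (b'' * c'')] q K)
       * vwp_W a [b, c, b', c', b'', c'',
           q powi (- int N), q powi (- int L), q powi (- int K)] q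
           (a ^ 4 * q ^ (N + L + K + 4) / (b * c * b' * c' * b'' * c''))"
proof -
  define Q where "Q M = inverse (q ^ M)" for M
  have powi: "q powi (- int M) = Q M" for M by (simp add: Q_def power_int_minus)
  define R where "R = min N (min L K)"
  have q: "q \<noteq> 0" "norm q < 1" using nonzero q_less by simp_all
  define f where "f b c M n = qpoch b q n * qpoch c q n * qpoch (Q M) q n * q ^ n / qpoch (b * c * Q M / a) q n"
    for b c M n
  define pre where "pre b c M = qpochs [q * a / b, q * a / c] q M / qpochs [q * a, q * a / (b * c)] q M"
    for b c M
  define h where "h b c M m = qpoch b q m * qpoch c q m * qpoch (Q M) q m
          / (qpoch (q * a / b) q m * qpoch (q * a / c) q m * qpoch (q * a / Q M) q m)" for b c M m
  define z where "z b c M m = (q * a / (b * c)) ^ m * (- 1) ^ m * q ^ (M * m) / q ^ (m choose 2)" for b c M m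
  have den: "vwp_den a [b, c, b', c', b'', c'', Q N, Q L, Q K] q m \<noteq> 0" if "m \<le> R" for m
    using den_W[of m] that by (simp add: powi R_def)
  have A: "qpoch (q * a) q (n + l) \<noteq> 0" "qpoch (q * a) q (n + k) \<noteq> 0" "qpoch (q * a) q (l + k) \<noteq> 0"
    if "n \<le> N" "l \<le> L" "k \<le> K" for n l k
    using den_mixed[OF that] by auto
  \<comment> \<open>Bailey's lemma needs (qa)_{N+m} nonzero. This is an instance of
    \<open>den_mixed\<close> with \<open>m\<close> in the place of \<open>l\<close>, allowed since m
    <= R <= L; for \<open>L\<close> and \<open>K\<close> the index \<open>m\<close> takes the place
    of \<open>n\<close>.\<close>
  have fsum: "(\<Sum>n\<le>N. f b c N n * bailey_mat a q n m) = pre b c N * h b c N m * z b c N m"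
    "(\<Sum>l\<le>L. f b' c' L l * bailey_mat a q l m) = pre b' c' L * h b' c' L m * z b' c' L m"
    "(\<Sum>k\<le>K. f b'' c'' K k * bailey_mat a q k m) = pre b'' c'' K * h b'' c'' K m * z b'' c'' K m"
    if m: "m \<le> R" for m
  proof -
    have mR: "m \<le> N" "m \<le> L" "m \<le> K" using m by (simp_all add: R_def)
    note d = den[OF m, unfolded vwp_den_def qpochs_def, simplified]
    show "(\<Sum>n\<le>N. f b c N n * bailey_mat a q n m) = pre b c N * h b c N m * z b c N m"
      using bailey_lemma_reversed[OF q, of a b c m N] nonzero mR A(1)[of N m 0] d den_N den_n[of N, unfolded powi]
      by (simp add: f_def pre_def h_def z_def Q_def qpochs_def)
    show "(\<Sum>l\<le>L. f b' c' L l * bailey_mat a q l m) = pre b' c' L * h b' c' L m * z b' c' L m"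
      using bailey_lemma_reversed[OF q, of a b' c' m L] nonzero mR A(1)[of m L 0] d den_L den_l[of L, unfolded powi]
      by (simp add: f_def pre_def h_def z_def Q_def qpochs_def add.commute)
    show "(\<Sum>k\<le>K. f b'' c'' K k * bailey_mat a q k m) = pre b'' c'' K * h b'' c'' K m * z b'' c'' K m"
      using bailey_lemma_reversed[OF q, of a b'' c'' m K] nonzero mR A(2)[of m 0 K] d den_K den_k[of K, unfolded powi]
      by (simp add: f_def pre_def h_def z_def Q_def qpochs_def add.commute)
  qed
  have term_W: "vwp_num a [b, c, b', c', b'', c'', Q N, Q L, Q K] q m
      / vwp_den a [b, c, b', c', b'', c'', Q N, Q L, Q K] q m
      * (a ^ 4 * q ^ (N + L + K + 4) / (b * c * b' * c' * b'' * c'')) ^ m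
    = vwp_coeff a q m * (h b c N m * z b c N m) * (h b' c' L m * z b' c' L m) * (h b'' c'' K m * z b'' c'' K m)"
    if m: "m \<le> R" for m
  proof -
    have mR: "m \<le> N" "m \<le> L" "m \<le> K" using m by (simp_all add: R_def)
    note d = den[OF m, unfolded vwp_den_def qpochs_def, simplified]
    have w: "vwp_weight a q m = qpoch a q m * qpoch (q * csqrt a) q m * qpoch (- (q * csqrt a)) q m
        / (qpoch (csqrt a) q m * qpoch (- csqrt a) q m)"
      using d by (intro vwp_weight_eq[symmetric]) (simp_all flip: power2_eq_square)
    have "vwp_num a [b, c, b', c', b'', c'', Q N, Q L, Q K] q m
        / vwp_den a [b, c, b', c', b'', c'', Q N, Q L, Q K] q m
      = vwp_weight a q m / qpoch q q m * h b c N m * h b' c' L m * h b'' c'' K m"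
      unfolding w h_def vwp_num_def vwp_den_def qpochs_def by (simp add: mult_ac)
    \<comment> \<open>Three of the four factors qa come from the triples as qa/(bc), the fourth from
      the 6-phi-5 coefficient. Of the four signs one belongs to the coefficient and three to
      \<open>z\<close>; the cube of q^(m choose 2) cancels the three denominators in
      \<open>z\<close>.\<close>
    moreover have "(a ^ 4 * q ^ (N + L + K + 4) / (b * c * b' * c' * b'' * c'')) ^ m
      = (- 1) ^ m * q ^ (m choose 2) * (q ^ (m choose 2))\<^sup>2 * (q * a) ^ m
         * (z b c N m * z b' c' L m * z b'' c'' K m)"
    proof -
      have sgn: "(- 1) ^ m * (- 1) ^ m * (- 1) ^ m * (- 1) ^ m = (1 :: complex)"
        by (simp flip: power_mult_distrib)
      have "a ^ 4 * q ^ (N + L + K + 4) / (b * c * b' * c' * b'' * c'')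
         = (q * a) * (q * a / (b * c)) * (q * a / (b' * c')) * (q * a / (b'' * c'')) * (q ^ N * q ^ L * q ^ K)"
        by (simp add: power_add power4_eq_xxxx mult_ac)
      then have "(a ^ 4 * q ^ (N + L + K + 4) / (b * c * b' * c' * b'' * c'')) ^ m
         = ((- 1) ^ m * (- 1) ^ m * (- 1) ^ m * (- 1) ^ m) *
           ((q * a) ^ m * (q * a / (b * c)) ^ m * (q * a / (b' * c')) ^ m * (q * a / (b'' * c'')) ^ m
          * (q ^ (N * m) * q ^ (L * m) * q ^ (K * m)))"
        unfolding sgn by (simp only: power_mult_distrib power_mult mult_1)
      also have "\<dots> = (- 1) ^ m * q ^ (m choose 2) * (q ^ (m choose 2))\<^sup>2 * (q * a) ^ m
         * (z b c N m * z b' c' L m * z b'' c'' K m)"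
        unfolding z_def using q(1) by (simp add: power2_eq_square del: power_mult_distrib)
      finally show ?thesis .
    qed
    ultimately show ?thesis by (simp add: vwp_coeff_def)
  qed
  have W: "vwp_W a [b, c, b', c', b'', c'', Q N, Q L, Q K] q
           (a ^ 4 * q ^ (N + L + K + 4) / (b * c * b' * c' * b'' * c''))
    = (\<Sum>m\<le>R. vwp_coeff a q m * (h b c N m * z b c N m) * (h b' c' L m * z b' c' L m) * (h b'' c'' K m * z b'' c'' K m))"
  proof -
    have "vwp_num a [b, c, b', c', b'', c'', Q N, Q L, Q K] q m = 0" if "m \<notin> {..R}" for m
    proof -
      have "N < m \<or> L < m \<or> K < m" using that by (auto simp: R_def)
      then show ?thesis using qpoch_neg_power_eq_0[OF q(1)] by (auto simp: vwp_num_def qpochs_def Q_def)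
    qed
    then show ?thesis unfolding vwp_W_def
      by (subst suminf_finite[of "{..R}"], simp, simp, intro sum.cong refl term_W, simp)
  qed
  \<comment> \<open>The range of \<open>m\<close> must be independent of n, l, k before sums can be
    interchanged. Both {..R} and {..n} contain {..min n (min l k)}, outside which a matrix entry is
    zero.\<close>
  have kernel: "qpoch (q * a) q (n + l + k)
        / (qpoch (q * a) q (n + l) * qpoch (q * a) q (n + k) * qpoch (q * a) q (l + k))
      = qpoch q q n * qpoch q q l * qpoch q q k
        * (\<Sum>m\<le>R. vwp_coeff a q m * bailey_mat a q n m * bailey_mat a q l m * bailey_mat a q k m)"
    if "n \<le> N" "l \<le> L" "k \<le> K" for n l k
  proof -
    define T where "T m = vwp_coeff a q m * bailey_mat a q n m * bailey_mat a q l m * bailey_mat a q k m" for m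
    have T0: "T m = 0" if "n < m \<or> l < m \<or> k < m" for m
      using that by (auto simp: T_def bailey_mat_def)
    have "(\<Sum>m\<le>R. T m) = (\<Sum>m\<le>min n (min l k). T m)"
      using that by (intro sum.mono_neutral_right) (auto simp: R_def intro!: T0)
    also have "\<dots> = (\<Sum>m\<le>n. T m)"
      by (intro sum.mono_neutral_left) (auto intro!: T0)
    also have "\<dots> = qpoch (q * a) q (n + l + k) / (qpoch q q n * qpoch q q l * qpoch q q k
        * (qpoch (q * a) q (n + l) * qpoch (q * a) q (n + k) * qpoch (q * a) q (l + k)))"
      unfolding T_def by (rule six_phi_five[OF q A[OF that]])
    finally show ?thesis
      unfolding T_def using qpoch_self_nonzero[OF q(2)] by simp
  qed
  have summand: "qpoch (q * a) q (n + l + k)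
          / (qpoch (q * a) q (n + l) * qpoch (q * a) q (n + k) * qpoch (q * a) q (l + k))
        * (qpochs [b, c, Q N] q n / qpochs [q, b * c * Q N / a] q n)
        * (qpochs [b', c', Q L] q l / qpochs [q, b' * c' * Q L / a] q l)
        * (qpochs [b'', c'', Q K] q k / qpochs [q, b'' * c'' * Q K / a] q k)
        * q ^ (n + l + k)
    = (\<Sum>m\<le>R. vwp_coeff a q m * (f b c N n * bailey_mat a q n m) * (f b' c' L l * bailey_mat a q l m)
          * (f b'' c'' K k * bailey_mat a q k m))"
    if "n \<le> N" "l \<le> L" "k \<le> K" for n l k
  proof -
    \<comment> \<open>\<open>X\<close>, \<open>Y\<close>, \<open>Z\<close> stand for (q)_n, (q)_l,
      (q)_k, which cancel between the kernel and the three single-index quotients.\<close>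
    have cancel: "X * Y * Z * S * (U / (X * u)) * (V / (Y * v)) * (W / (Z * w)) * (x * y * t)
       = (U * x / u) * (V * y / v) * (W * t / w) * S"
      if "X \<noteq> 0" "Y \<noteq> 0" "Z \<noteq> 0" for X Y Z S U u V v W w x y t :: complex
      using that by (simp add: mult_ac)
    have "qpoch (q * a) q (n + l + k)
          / (qpoch (q * a) q (n + l) * qpoch (q * a) q (n + k) * qpoch (q * a) q (l + k))
        * (qpochs [b, c, Q N] q n / qpochs [q, b * c * Q N / a] q n)
        * (qpochs [b', c', Q L] q l / qpochs [q, b' * c' * Q L / a] q l)
        * (qpochs [b'', c'', Q K] q k / qpochs [q, b'' * c'' * Q K / a] q k)
        * q ^ (n + l + k)
      = f b c N n * f b' c' L l * f b'' c'' K k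
        * (\<Sum>m\<le>R. vwp_coeff a q m * bailey_mat a q n m * bailey_mat a q l m * bailey_mat a q k m)"
      unfolding kernel[OF that] f_def qpochs_def power_add list.map prod_list.Cons prod_list.Nil mult_1_right
        mult.assoc[symmetric, of "qpoch _ q _" "qpoch _ q _" "qpoch _ q _"]
      by (rule cancel) (simp_all add: qpoch_self_nonzero[OF q(2)])
    then show ?thesis unfolding sum_distrib_left by (simp only: mult_ac)
  qed
  have swap: "(\<Sum>n\<le>N. \<Sum>l\<le>L. \<Sum>k\<le>K. \<Sum>m\<le>R. w m * u n m * v l m * t k m)
      = (\<Sum>m\<le>R. w m * (\<Sum>n\<le>N. u n m) * (\<Sum>l\<le>L. v l m) * (\<Sum>k\<le>K. t k m))"
    for w :: "nat \<Rightarrow> complex" and u v t :: "nat \<Rightarrow> nat \<Rightarrow> complex"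
  proof -
    have "(\<Sum>n\<le>N. \<Sum>l\<le>L. \<Sum>k\<le>K. \<Sum>m\<le>R. w m * u n m * v l m * t k m)
       = (\<Sum>n\<le>N. \<Sum>l\<le>L. \<Sum>m\<le>R. \<Sum>k\<le>K. w m * u n m * v l m * t k m)"
      by (intro sum.cong refl sum.swap)
    also have "\<dots> = (\<Sum>n\<le>N. \<Sum>m\<le>R. \<Sum>l\<le>L. \<Sum>k\<le>K. w m * u n m * v l m * t k m)"
      by (intro sum.cong refl sum.swap)
    also have "\<dots> = (\<Sum>m\<le>R. \<Sum>n\<le>N. \<Sum>l\<le>L. \<Sum>k\<le>K. w m * u n m * v l m * t k m)"
      by (rule sum.swap)
    finally show ?thesis
      by (simp only: sum_distrib_left[symmetric] sum_distrib_right[symmetric])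
  qed
  show ?thesis (is "?lhs = ?rhs")
  proof -
    have "?lhs = (\<Sum>m\<le>R. vwp_coeff a q m * (\<Sum>n\<le>N. f b c N n * bailey_mat a q n m)
        * (\<Sum>l\<le>L. f b' c' L l * bailey_mat a q l m) * (\<Sum>k\<le>K. f b'' c'' K k * bailey_mat a q k m))"
      unfolding powi atLeast0AtMost swap[symmetric] by (intro sum.cong refl summand) simp_all
    also have "\<dots> = (\<Sum>m\<le>R. vwp_coeff a q m * (pre b c N * h b c N m * z b c N m)
        * (pre b' c' L * h b' c' L m * z b' c' L m) * (pre b'' c'' K * h b'' c'' K m * z b'' c'' K m))"
      by (intro sum.cong refl) (simp add: fsum)
    also have "\<dots> = ?rhs"
      unfolding powi W pre_def[symmetric] sum_distrib_left
      by (intro sum.cong refl) (simp only: mult_ac)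
    finally show ?thesis .
  qed
qed

end
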